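(* Let $\alpha\in(0,1]$. Consider the marginal subspace detection estimator $\widehat{\mathcal{A}}:=\{k\in\{1,\dots,N\}:T_k(y)>\tau_k\}$. Its family-wise error rate satisfies $\mathrm{FWER}:=\Pr(\widehat{\mathcal{A}}\not\subset\mathcal{A})\le\alpha$ if the thresholds are chosen as follows: (1) for bounded deterministic error $\|\eta\|_2<\epsilon_\eta$: $$\tau_k=\left(\epsilon_\eta+\rho_k\sqrt{n\,\mathcal{E}_{\mathcal{A}}}+\frac{\gamma_{2,k}N}{N-n}\sqrt{c_0^{-1}\mathcal{E}_{\mathcal{A}}\log\!\big(\tfrac{e^2N}{\alpha}\big)}\right)^2,\quad k=1,\dots,N;$$ (2) for Gaussian noise $\eta\sim\mathcal{N}(0,\sigma^2 I_D)$: $$\tau_k=\left(\sigma\sqrt{d+2\log\!\big(\tfrac{2N}{\alpha}\big)+2\sqrt{d\log\!\big(\tfrac{2N}{\alpha}\big)}}+\rho_k\sqrt{n\,\mathcal{E}_{\mathcal{A}}}+\frac{\gamma_{2,k}N}{N-n}\sqrt{c_0^{-1}\mathcal{E}_{\mathcal{A}}\log\!\big(\tfrac{2e^2N}{\alpha}\big)}\right)^2,\quad k=1,\dots,N.$$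
   Context: Setting: $\mathcal{S}_1,\dots,\mathcal{S}_N$ are $d$-dimensional subspaces of $\mathbb{R}^D$ that are pairwise disjoint ($\mathcal{S}_i\cap\mathcal{S}_j=\{0\}$ for $i\ne j$), with $N\ge 3$ and $1\le n<N$. Each $\mathcal{S}_i$ has a fixed "mixing basis" $\Phi_i\in\mathbb{R}^{D\times d}$ with $\Phi_i^\top\Phi_i=I$ and $\mathrm{span}(\Phi_i)=\mathcal{S}_i$. The active indices are given by a uniformly random ordered $n$-tuple $(i_1,\dots,i_n)$ of distinct elements of $\{1,\dots,N\}$ (so $\mathcal{A}=\{i_1,\dots,i_n\}$ is a uniformly random $n$-subset), and there are deterministic vectors $\theta_1,\dots,\theta_n\in\mathbb{R}^d$; the signal is $x=\sum_{j=1}^n\Phi_{i_j}\theta_j$ and the observation is $y=x+\eta$, where $\eta$ is either a deterministic vector with $\|\eta\|_2<\epsilon_\eta$, or $\eta\sim\mathcal{N}(0,\sigma^2 I_D)$ independent of the activity pattern. Test statistic: $T_k(y):=\|U_k^\top y\|_2^2$ for any orthonormal basis $U_k$ of $\mathcal{S}_k$. Subspace coherence: $\gamma(\mathcal{S}_i,\mathcal{S}_j):=\max_{w\in\mathcal{S}_i,z\in\mathcal{S}_j}\frac{|\langle w,z\rangle|}{\|w\|_2\|z\|_2}=\|U_i^\top U_j\|_2$. Local 2-subspace coherence: $\gamma_{2,k}:=\max_{j\ne k,\,l\ne k,\,j\ne l}[\gamma(\mathcal{S}_k,\mathcal{S}_j)+\gamma(\mathcal{S}_k,\mathcal{S}_l)]$.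 Average mixing coherence: $\rho_k:=\frac{1}{N-1}\big\|\sum_{j\ne k}\Phi_k^\top\Phi_j\big\|_2$. Cumulative active subspace energy: $\mathcal{E}_{\mathcal{A}}:=\sum_{j=1}^n\|\theta_j\|_2^2$. Constant: $c_0:=\frac{e^{-1}}{256}$. *)

theory Defs
  imports "HOL-Probability.Probability"
begin

text \<open>Conventions: ambient space R^D is real^'D, coefficient space R^d is real^'d.
 Subspaces are indexed by 0..<N, active coefficient vectors theta by 0..<n.
 A mixing basis Phi k is a D x d matrix (real^'d^'D).\<close>

definition subspace_of :: "real^'d^'D \<Rightarrow> (real^'D) set" where
  "subspace_of P = range (\<lambda>t. P *v t)"

definition subspace_coherence :: "('a::real_inner) set \<Rightarrow> 'a set \<Rightarrow> real" where
  "subspace_coherence S T =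
     Sup {\<bar>w \<bullet> z\<bar> / (norm w * norm z) | w z. w \<in> S \<and> z \<in> T \<and> w \<noteq> 0 \<and> z \<noteq> 0}"

definition local_2_coherence :: "nat \<Rightarrow> (nat \<Rightarrow> real^'d^'D) \<Rightarrow> nat \<Rightarrow> real" where
  "local_2_coherence N Phi k =
     Max {subspace_coherence (subspace_of (Phi k)) (subspace_of (Phi j))
          + subspace_coherence (subspace_of (Phi k)) (subspace_of (Phi l))
          | j l. j < N \<and> l < N \<and> j \<noteq> k \<and> l \<noteq> k \<and> j \<noteq> l}"

definition avg_mixing_coherence :: "nat \<Rightarrow> (nat \<Rightarrow> real^'d^'D) \<Rightarrow> nat \<Rightarrow> real" where
  "avg_mixing_coherence N Phi k =
     onorm (\<lambda>v. (\<Sum>j\<in>{0..<N} - {k}. transpose (Phi k) ** Phi j) *v v) / (real N - 1)"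

text \<open>Test statistic T_k(y) = ||U_k^T y||^2, with U_k = Phi k (an orthonormal basis of S_k).\<close>
definition test_stat :: "(nat \<Rightarrow> real^'d^'D) \<Rightarrow> nat \<Rightarrow> real^'D \<Rightarrow> real" where
  "test_stat Phi k y = (norm (transpose (Phi k) *v y))\<^sup>2"

definition msd_estimate :: "nat \<Rightarrow> (nat \<Rightarrow> real^'d^'D) \<Rightarrow> (nat \<Rightarrow> real) \<Rightarrow> real^'D \<Rightarrow> nat set" where
  "msd_estimate N Phi tau y = {k. k < N \<and> test_stat Phi k y > tau k}"

definition tuples :: "nat \<Rightarrow> nat \<Rightarrow> nat list set" where
  "tuples N n = {xs. length xs = n \<and> distinct xs \<and> set xs \<subseteq> {0..<N}}"

definition signal :: "(nat \<Rightarrow> real^'d^'D) \<Rightarrow> (nat \<Rightarrow> real^'d) \<Rightarrow> nat list \<Rightarrow> real^'D" where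
  "signal Phi theta xs = (\<Sum>j<length xs. Phi (xs ! j) *v theta j)"

definition energy :: "nat \<Rightarrow> (nat \<Rightarrow> real^'d) \<Rightarrow> real" where
  "energy n theta = (\<Sum>j<n. (norm (theta j))\<^sup>2)"

definition c0 :: real where "c0 = exp (-1) / 256"

definition gaussian_vec :: "real \<Rightarrow> (real^'D) measure" where
  "gaussian_vec \<sigma> = density lborel (\<lambda>x::real^'D.
     ennreal ((2 * pi * \<sigma>\<^sup>2) powr (- real CARD('D) / 2) * exp (- (norm x)\<^sup>2 / (2 * \<sigma>\<^sup>2))))"

definition tau_det :: "nat \<Rightarrow> nat \<Rightarrow> (nat \<Rightarrow> real^'d^'D) \<Rightarrow> (nat \<Rightarrow> real^'d) \<Rightarrow> real \<Rightarrow> real \<Rightarrow> nat \<Rightarrow> real" where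
  "tau_det N n Phi theta \<epsilon> \<alpha> k =
     (\<epsilon> + avg_mixing_coherence N Phi k * sqrt (real n * energy n theta)
      + local_2_coherence N Phi k * real N / (real N - real n)
        * sqrt (energy n theta * ln (exp 2 * real N / \<alpha>) / c0))\<^sup>2"

definition tau_gauss :: "nat \<Rightarrow> nat \<Rightarrow> (nat \<Rightarrow> real^'d^'D) \<Rightarrow> (nat \<Rightarrow> real^'d) \<Rightarrow> real \<Rightarrow> real \<Rightarrow> nat \<Rightarrow> real" where
  "tau_gauss N n Phi theta \<sigma> \<alpha> k =
     (\<sigma> * sqrt (real CARD('d) + 2 * ln (2 * real N / \<alpha>)
                + 2 * sqrt (real CARD('d) * ln (2 * real N / \<alpha>)))
      + avg_mixing_coherence N Phi k * sqrt (real n * energy n theta)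
      + local_2_coherence N Phi k * real N / (real N - real n)
        * sqrt (energy n theta * ln (2 * exp 2 * real N / \<alpha>) / c0))\<^sup>2"

end

theory Submission
  imports Defs
begin

text \<open>
  Fix k and condition on k being inactive: the active indices are then drawn without replacement from
  the remaining N - 1. The projected signal is its conditional mean, controlled by the average mixing
  coherence, plus a deviation. Revealing the indices one at a time turns the deviation into a
  martingale: if a is drawn from a pool of size m, the increment is A_a u minus the pool average of
  A_b u, where u is the current coefficient minus 1/(m - 1) times the sum of the later ones, so its
  norm is at most the local 2-subspace coherence times |u|. The potential exp (sqrt (1 + |x|^2)) grows
  at most by the factor exp (b^2) in a mean-zero step of norm at most b (concavity of the square root
  and Hoeffding's lemma), which gives a dimension-free tail bound far better than what c0 requires.
  For Gaussian noise this is combined with a Laurent--Massart bound for the chi-square tail, and a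
  union bound over k finishes the proof.
\<close>

subsection \<open>Vector-valued sampling without replacement\<close>

text \<open>A smooth substitute for the norm: it dominates the norm, and its gradient
  \<open>x / potential x\<close> has norm below 1 with no singularity at the origin.\<close>

definition potential :: "'a::real_inner \<Rightarrow> real" where
  "potential x = sqrt (1 + (norm x)\<^sup>2)"

lemma potential_ge_1: "1 \<le> potential x"
  by (simp add: potential_def)

lemma norm_le_potential: "norm x \<le> potential x"
  unfolding potential_def by (rule real_le_rsqrt) simp

text \<open>Concavity of the square root gives the first-order expansion with remainder |v|^2 / (2 *
  potential x), and the potential is at least 1.\<close>

lemma potential_add_le:
  "potential (x + v) \<le> potential x + (x \<bullet> v) / potential x + (norm v)\<^sup>2 / 2"
proof -
  define r where "r = potential x"
  have r: "1 \<le> r" "r\<^sup>2 = 1 + (norm x)\<^sup>2"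
    unfolding r_def potential_def by (auto intro: add_nonneg_nonneg)
  define w where "w = 2 * (x \<bullet> v) + (norm v)\<^sup>2"
  have eq: "1 + (norm (x + v))\<^sup>2 = r\<^sup>2 + w"
    unfolding r w_def by (simp add: power2_norm_eq_inner inner_add inner_commute)
  \<comment> \<open>Tangent line of the square root at \<open>r\<^sup>2\<close>: squaring the
    right-hand side leaves the nonnegative excess \<open>(w / (2 * r))\<^sup>2\<close>.\<close>
  have "sqrt (r\<^sup>2 + w) \<le> r + w / (2 * r)"
  proof (rule real_le_lsqrt)
    have "0 \<le> r\<^sup>2 + w" using eq by (metis add_nonneg_nonneg zero_le_one zero_le_power2)
    then have "0 \<le> (r\<^sup>2 + (r\<^sup>2 + w)) / (2 * r)"
      using r(1) zero_le_power2[of r] by (intro divide_nonneg_nonneg) linarith+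
    also have "\<dots> = r + w / (2 * r)" using r by (simp add: field_simps power2_eq_square)
    finally show "0 \<le> r + w / (2 * r)" .
    have "(r + w / (2 * r))\<^sup>2 = r\<^sup>2 + w + (w / (2 * r))\<^sup>2"
      using r(1) by (simp add: field_simps power2_eq_square)
    then show "r\<^sup>2 + w \<le> (r + w / (2 * r))\<^sup>2" by simp
  qed
  also have "r + w / (2 * r) = r + (x \<bullet> v) / r + (norm v)\<^sup>2 / (2 * r)"
    using r by (simp add: w_def field_simps)
  also have "(norm v)\<^sup>2 / (2 * r) \<le> (norm v)\<^sup>2 / 2"
    using r by (intro divide_left_mono) auto
  finally show ?thesis by (simp add: potential_def[of "x + v"] eq r_def)
qed

text \<open>Hoeffding's lemma for a centered variable under the uniform distribution on
  \<open>P\<close>: a range of length 2b gives the exponent (2b)^2 / 8.\<close>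

lemma sum_exp_le_Hoeffding:
  fixes f :: "'i \<Rightarrow> real"
  assumes "finite P" and "(\<Sum>a\<in>P. f a) = 0" and "\<And>a. a \<in> P \<Longrightarrow> \<bar>f a\<bar> \<le> b"
  shows "(\<Sum>a\<in>P. exp (f a)) \<le> real (card P) * exp (b\<^sup>2 / 2)"
proof (cases "P = {}")
  case False
  interpret interval_bounded_random_variable "measure_pmf (pmf_of_set P)" f "-b" b
    by unfold_locales
      (use assms False in \<open>auto simp: AE_measure_pmf_iff abs_le_iff minus_le_iff\<close>)
  have "measure_pmf.expectation (pmf_of_set P) f = 0"
    using assms False by (simp add: integral_pmf_of_set)
  from Hoeffdings_lemma_nn_integral_0[of 1, OF _ this]
  have "(\<integral>\<^sup>+x. ennreal (exp (f x)) \<partial>measure_pmf (pmf_of_set P)) \<le> ennreal (exp (b\<^sup>2 / 2))"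
    by (simp add: power2_eq_square algebra_simps)
  also have "(\<integral>\<^sup>+x. ennreal (exp (f x)) \<partial>measure_pmf (pmf_of_set P)) =
      ennreal ((\<Sum>a\<in>P. exp (f a)) / card P)"
  proof -
    have "finite (set_pmf (pmf_of_set P))" using assms False by simp
    then show ?thesis
      using assms False
      by (subst nn_integral_eq_integral)
         (simp_all add: integral_pmf_of_set integrable_measure_pmf_finite)
  qed
  finally have "(\<Sum>a\<in>P. exp (f a)) / card P \<le> exp (b\<^sup>2 / 2)"
    by (simp add: ennreal_le_iff)
  then show ?thesis
    using assms False by (simp add: divide_le_eq card_gt_0_iff mult.commute)
qed simp

text \<open>Half of the exponent \<open>b\<^sup>2\<close> comes from Hoeffding's lemma for the
  linear term of the expansion, which averages to zero and is bounded by \<open>b\<close>; the other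
  half is the quadratic remainder.\<close>

lemma sum_exp_potential_le:
  fixes v :: "'i \<Rightarrow> 'a::real_inner"
  assumes "finite P" and "(\<Sum>a\<in>P. v a) = 0" and "\<And>a. a \<in> P \<Longrightarrow> norm (v a) \<le> b"
  shows "(\<Sum>a\<in>P. exp (potential (x + v a))) \<le> real (card P) * exp (potential x + b\<^sup>2)"
proof -
  define f where "f a = (x \<bullet> v a) / potential x" for a
  have r: "0 < potential x" using potential_ge_1[of x] by simp
  have "(\<Sum>a\<in>P. exp (f a)) \<le> real (card P) * exp (b\<^sup>2 / 2)"
  proof (rule sum_exp_le_Hoeffding)
    show "sum f P = 0"
      using assms(2) by (simp add: f_def flip: sum_divide_distrib inner_sum_right)
    fix a assume a: "a \<in> P"
    have "\<bar>x \<bullet> v a\<bar> \<le> norm x * norm (v a)" by (rule Cauchy_Schwarz_ineq2)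
    also have "\<dots> \<le> potential x * b"
      using r by (intro mult_mono norm_le_potential assms(3)[OF a]) auto
    finally show "\<bar>f a\<bar> \<le> b"
      using r by (simp add: f_def abs_div divide_le_eq mult.commute)
  qed (use assms in auto)
  moreover have "exp (potential (x + v a)) \<le> exp (potential x + b\<^sup>2 / 2) * exp (f a)"
    if "a \<in> P" for a
  proof -
    have "(norm (v a))\<^sup>2 \<le> b\<^sup>2" using assms(3)[OF that] by (intro power_mono) auto
    then have "potential (x + v a) \<le> (potential x + b\<^sup>2 / 2) + f a"
      using potential_add_le[of x "v a"] by (simp add: f_def)
    then show ?thesis by (simp flip: exp_add)
  qed
  then have "(\<Sum>a\<in>P. exp (potential (x + v a))) \<le>
      (\<Sum>a\<in>P. exp (potential x + b\<^sup>2 / 2) * exp (f a))"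
    by (rule sum_mono)
  ultimately have "(\<Sum>a\<in>P. exp (potential (x + v a))) \<le>
      exp (potential x + b\<^sup>2 / 2) * (real (card P) * exp (b\<^sup>2 / 2))"
    unfolding sum_distrib_left[symmetric] by (meson exp_ge_zero mult_left_mono order_trans)
  also have "\<dots> = real (card P) * exp (potential x + b\<^sup>2)"
    by (simp flip: exp_add)
  finally show ?thesis .
qed

section \<open>Ordered tuples without repetition\<close>

text \<open>The pool is an arbitrary set because each draw removes an index from it, and
  conditioning on an inactive index removes that index as well.\<close>

definition injective_tuples :: "'i set \<Rightarrow> nat \<Rightarrow> 'i list set" where
  "injective_tuples P n = {xs. length xs = n \<and> distinct xs \<and> set xs \<subseteq> P}"

lemma injective_tuples_0 [simp]: "injective_tuples P 0 = {[]}"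
  by (auto simp: injective_tuples_def)

lemma finite_injective_tuples: "finite P \<Longrightarrow> finite (injective_tuples P n)"
  unfolding injective_tuples_def
  by (rule finite_subset[OF _ finite_lists_length_eq[of P n]]) auto

lemma sum_injective_tuples_Suc:
  assumes "finite P"
  shows "sum F (injective_tuples P (Suc n)) =
    (\<Sum>a\<in>P. \<Sum>ys\<in>injective_tuples (P - {a}) n. F (a # ys))"
proof -
  have "(\<Sum>a\<in>P. \<Sum>ys\<in>injective_tuples (P - {a}) n. F (a # ys)) =
      (\<Sum>(a, ys)\<in>Sigma P (\<lambda>a. injective_tuples (P - {a}) n). F (a # ys))"
    using assms by (intro sum.Sigma) (auto intro: finite_injective_tuples)
  also have "\<dots> = sum F (injective_tuples P (Suc n))"
    by (rule sum.reindex_bij_witness[where i = "\<lambda>xs. (hd xs, tl xs)" and j = "\<lambda>(a, ys). a # ys"])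
      (auto simp: injective_tuples_def length_Suc_conv)
  finally show ?thesis by simp
qed

text \<open>The number of continuations does not depend on the first draw, so a uniform tuple has a
  uniform first entry and, given that entry, a uniform tail.\<close>

lemma card_injective_tuples_Suc:
  assumes "finite P" "a \<in> P" "n < card P"
  shows "card (injective_tuples P (Suc n)) = card P * card (injective_tuples (P - {a}) n)"
proof -
  have "card (injective_tuples P (Suc n)) = (\<Sum>b\<in>P. card (injective_tuples (P - {b}) n))"
    using sum_injective_tuples_Suc[OF assms(1), of "\<lambda>_. 1 :: nat" n]
    by (simp only: card_eq_sum)
  also have "\<dots> = (\<Sum>b\<in>P. card (injective_tuples (P - {a}) n))"
    using assms unfolding injective_tuples_def
    by (intro sum.cong refl) (subst (1 2) card_lists_distinct_length_eq, auto)
  finally show ?thesis by simp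
qed

section \<open>The centered sampled sum and its martingale decomposition\<close>

definition mean_on :: "'i set \<Rightarrow> ('i \<Rightarrow> 'a::real_vector) \<Rightarrow> 'a" where
  "mean_on P f = (\<Sum>a\<in>P. f a) /\<^sub>R real (card P)"

text \<open>Every entry of a uniform tuple is uniform on \<open>P\<close>, so for linear
  \<open>A a\<close> the subtracted term is the expectation of the sum.\<close>

definition deviation ::
  "('i \<Rightarrow> 'e::real_vector \<Rightarrow> 'a::real_inner) \<Rightarrow> (nat \<Rightarrow> 'e) \<Rightarrow> 'i set \<Rightarrow> 'i list \<Rightarrow> 'a" where
  "deviation A \<theta> P xs = (\<Sum>j<length xs. A (xs ! j) (\<theta> j))
     - mean_on P (\<lambda>a. A a (\<Sum>j<length xs. \<theta> j))"

text \<open>Revealing \<open>a\<close> changes the mean of the later terms from an average over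
  \<open>P\<close> to one over \<open>P - {a}\<close>. This change is linear in the sum
  \<open>s\<close> of the later coefficients and merges with the new term into a single centered
  increment with effective coefficient \<open>u\<close>.\<close>

lemma deviation_Cons:
  fixes A :: "'i \<Rightarrow> 'e::real_vector \<Rightarrow> 'a::real_inner"
  assumes lin: "\<And>a. linear (A a)" and "finite P" "a \<in> P"
    and s: "s = (\<Sum>j<length ys. \<theta> (Suc j))" and ys: "ys \<in> injective_tuples (P - {a}) n"
    and u: "u = \<theta> 0 - s /\<^sub>R (real (card P) - 1)"
  shows "deviation A \<theta> P (a # ys) = (A a u - mean_on P (\<lambda>a. A a u))
      + deviation A (\<theta> \<circ> Suc) (P - {a}) ys"
proof (cases "card P = 1")
  \<comment> \<open>Here \<open>card P - 1\<close> vanishes, but nothing is left to draw, so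
    \<open>s\<close> is zero and the division by zero in \<open>u\<close> does no harm.\<close>
  case True
  then have "P = {a}" using assms by (metis card_1_singletonE singletonD)
  then have "ys = []" using ys by (auto simp: injective_tuples_def)
  then show ?thesis using True lin \<open>P = {a}\<close>
    by (simp add: deviation_def s u mean_on_def linear_0 linear_diff)
next
  case False
  define m where "m = real (card P)"
  have "card P \<noteq> 0" using assms by auto
  then have m: "m \<noteq> 0" "m - 1 \<noteq> 0" using False by (auto simp: m_def)
  have card: "real (card (P - {a})) = m - 1"
    using assms \<open>card P \<noteq> 0\<close> by (simp add: m_def of_nat_diff Suc_le_eq card_gt_0_iff)
  define S where "S w = (\<Sum>b\<in>P. A b w)" for w
  have S: "S (w + w') = S w + S w'" "S (w - w') = S w - S w'" "S (c *\<^sub>R w) = c *\<^sub>R S w" for w w' c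
    using lin by (auto simp: S_def linear_add linear_diff linear_cmul sum.distrib sum_subtractf scaleR_sum_right)
  have mean: "mean_on P (\<lambda>a. A a w) = S w /\<^sub>R m" for w by (simp add: mean_on_def S_def m_def)
  have mean': "mean_on (P - {a}) (\<lambda>a. A a w) = (S w - A a w) /\<^sub>R (m - 1)" for w
    unfolding mean_on_def card S_def using assms by (simp add: sum_diff1)
  have sum0: "(\<Sum>j<length (a # ys). \<theta> j) = \<theta> 0 + s"
    by (simp add: s sum.lessThan_Suc_shift del: sum.lessThan_Suc)
  have sum1: "(\<Sum>j<length (a # ys). A ((a # ys) ! j) (\<theta> j)) =
      A a (\<theta> 0) + (\<Sum>j<length ys. A (ys ! j) (\<theta> (Suc j)))"
    by (simp add: sum.lessThan_Suc_shift del: sum.lessThan_Suc)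
  have "inverse m *\<^sub>R S s + inverse (m-1) *\<^sub>R A a s =
      inverse (m-1) *\<^sub>R S s + (inverse (m-1) *\<^sub>R A a s - (inverse m * inverse (m-1)) *\<^sub>R S s)"
  proof -
    \<comment> \<open>Partial fractions: 1/(m-1) - 1/m = 1/(m(m-1)) accounts for the pool shrinking
      from m to m - 1.\<close>
    have *: "inverse m = inverse (m-1) - inverse m * inverse (m-1)"
      using division_ring_inverse_diff[OF m(2,1)] by (simp add: mult.commute)
    show ?thesis by (subst *) (simp add: scaleR_diff_left)
  qed
  then show ?thesis
    unfolding deviation_def sum0 sum1 mean mean' u S m_def[symmetric]
    using lin by (simp add: s[symmetric] S linear_diff linear_cmul algebra_simps)
qed

lemma norm_sum_power2_le:
  fixes f :: "nat \<Rightarrow> 'a::real_inner"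
  shows "(norm (\<Sum>j<n. f j))\<^sup>2 \<le> real n * (\<Sum>j<n. (norm (f j))\<^sup>2)"
proof -
  have "(norm (\<Sum>j<n. f j))\<^sup>2 \<le> (\<Sum>j<n. norm (f j))\<^sup>2"
    by (intro power_mono norm_sum) auto
  also have "\<dots> \<le> (\<Sum>j<n. (norm (f j))\<^sup>2) * (\<Sum>j<n. (1::real)\<^sup>2)"
    using Cauchy_Schwarz_ineq_sum[of "\<lambda>j. norm (f j)" "\<lambda>_. 1" "{..<n}"] by simp
  finally show ?thesis by (simp add: mult.commute)
qed

text \<open>Induction on the number of draws, with \<open>x\<close> absorbing the increments already
  revealed. \<open>q\<close> is invariant because the pool and the number of draws shrink together,
  and \<open>F\<close> still bounds the energy of the remaining coefficients. The last draw has no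
  later coefficients to correct for, hence the factor \<open>n - 1\<close>.\<close>

lemma sum_exp_potential_deviation_le:
  fixes A :: "'i \<Rightarrow> 'e::real_inner \<Rightarrow> 'a::real_inner"
  assumes "\<And>a. linear (A a)" and "finite P" "n \<le> card P"
    and "\<And>a b u. a \<in> P \<Longrightarrow> b \<in> P \<Longrightarrow> norm (A a u - A b u) \<le> G * norm u"
    and "q = real (card P) + 1 - real n" and "(\<Sum>j<n. (norm (\<theta> j))\<^sup>2) \<le> F"
  shows "(\<Sum>xs\<in>injective_tuples P n. exp (potential (x + deviation A \<theta> P xs))) \<le>
     real (card (injective_tuples P n)) *
       exp (potential x + G\<^sup>2 * (2 * (\<Sum>j<n. (norm (\<theta> j))\<^sup>2) + 2 * real (n - 1) * F / q))"
  using assms(2-)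
proof (induction n arbitrary: P \<theta> x)
  case 0
  then show ?case using assms(1) by (simp add: deviation_def mean_on_def linear_0)
next
  case (Suc n)
  define s where "s = (\<Sum>j<n. \<theta> (Suc j))"
  define u where "u = \<theta> 0 - s /\<^sub>R (real (card P) - 1)"
  define v where "v a = A a u - mean_on P (\<lambda>a. A a u)" for a
  define E where "E = (\<Sum>j<n. (norm (\<theta> (Suc j)))\<^sup>2)"
  define B where "B = G\<^sup>2 * (2 * E + 2 * real (n - 1) * F / q)"
  have P: "card P > 0" "P \<noteq> {}" "finite P" using Suc.prems by auto
  have q: "q \<ge> 1" using Suc.prems by simp
  have E: "E \<le> F" "0 \<le> E"
    using Suc.prems(5) unfolding E_def by (auto simp: sum.lessThan_Suc_shift intro!: sum_nonneg simp del: sum.lessThan_Suc)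
       (smt (verit) zero_le_power2)
  have sumv: "(\<Sum>a\<in>P. v a) = 0"
    using P by (simp add: v_def sum_subtractf mean_on_def sum_constant_scaleR)
  \<comment> \<open>The increment is an average of differences \<open>A a u - A b u\<close>. The
    absolute value appears since \<open>G\<close> may have any sign.\<close>
  have normv: "norm (v a) \<le> \<bar>G\<bar> * norm u" if "a \<in> P" for a
  proof -
    have "v a = (\<Sum>b\<in>P. A a u - A b u) /\<^sub>R real (card P)"
      using P by (simp add: v_def sum_subtractf mean_on_def scaleR_diff_right sum_constant_scaleR)
    also have "norm \<dots> \<le> (\<Sum>b\<in>P. norm (A a u - A b u)) / real (card P)"
      by (simp add: divide_inverse mult.commute mult_left_mono norm_sum)
    also have "\<dots> \<le> (\<Sum>b\<in>P. \<bar>G\<bar> * norm u) / real (card P)"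
    proof (intro divide_right_mono sum_mono)
      fix b assume "b \<in> P"
      have "norm (A a u - A b u) \<le> G * norm u" using Suc.prems(3)[OF that \<open>b \<in> P\<close>] .
      also have "\<dots> \<le> \<bar>G\<bar> * norm u" by (intro mult_right_mono) auto
      finally show "norm (A a u - A b u) \<le> \<bar>G\<bar> * norm u" .
    qed simp
    finally show ?thesis using P by simp
  qed
  \<comment> \<open>By truncated subtraction, \<open>real n - real (n - 1)\<close> is 1 if later
    draws exist and 0 at the last draw, where \<open>s\<close> is zero.\<close>
  have normu: "(norm u)\<^sup>2 \<le> 2 * (norm (\<theta> 0))\<^sup>2 + 2 * (real n - real (n - 1)) * F / q"
  proof (cases "n = 0")
    case True
    then show ?thesis by (simp add: u_def s_def)
  next
    case False
    define m where "m = real (card P) - 1"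
    have m: "real n \<le> m" "q \<le> m" "m > 0" using Suc.prems False by (auto simp: m_def)
    have "(norm u)\<^sup>2 \<le> (norm (\<theta> 0) + norm (s /\<^sub>R m))\<^sup>2"
      unfolding u_def m_def by (intro power_mono norm_triangle_ineq4) auto
    also have "\<dots> \<le> 2 * (norm (\<theta> 0))\<^sup>2 + 2 * (norm (s /\<^sub>R m))\<^sup>2"
      using sum_squares_bound[of "norm (\<theta> 0)" "norm (s /\<^sub>R m)"] by (simp add: power2_sum)
    also have "(norm (s /\<^sub>R m))\<^sup>2 = (norm s)\<^sup>2 / m\<^sup>2" using m by (simp add: power_divide divide_inverse power_mult_distrib power_inverse)
    also have "\<dots> \<le> (real n * E) / m\<^sup>2"
      unfolding s_def E_def by (intro divide_right_mono norm_sum_power2_le) auto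
    \<comment> \<open>The pool left after this draw has \<open>m\<close> elements and must supply
      \<open>n\<close> further draws, so \<open>n\<close> is at most \<open>m\<close> and one factor
      cancels.\<close>
    also have "\<dots> \<le> (m * F) / m\<^sup>2" using m E by (intro divide_right_mono mult_mono) auto
    also have "\<dots> = F / m" using m by (simp add: power2_eq_square)
    also have "\<dots> \<le> F / q" using m q E by (intro divide_left_mono) auto
    finally show ?thesis using False by (simp add: of_nat_diff)
  qed
  have IH: "(\<Sum>ys\<in>injective_tuples (P - {a}) n.
        exp (potential (x + deviation A \<theta> P (a # ys)))) \<le>
      real (card (injective_tuples (P - {a}) n)) * exp (potential (x + v a) + B)" if a: "a \<in> P" for a
  proof -
    have "(\<Sum>ys\<in>injective_tuples (P - {a}) n.
          exp (potential (x + deviation A \<theta> P (a # ys)))) =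
        (\<Sum>ys\<in>injective_tuples (P - {a}) n.
          exp (potential ((x + v a) + deviation A (\<theta> \<circ> Suc) (P - {a}) ys)))"
    proof (rule sum.cong[OF refl])
      fix ys assume ys: "ys \<in> injective_tuples (P - {a}) n"
      then have "length ys = n" by (simp add: injective_tuples_def)
      with deviation_Cons[OF assms(1) P(3) a _ ys, of s \<theta> u]
      show "exp (potential (x + deviation A \<theta> P (a # ys))) =
          exp (potential ((x + v a) + deviation A (\<theta> \<circ> Suc) (P - {a}) ys))"
        by (simp add: s_def u_def v_def add.assoc)
    qed
    also have "\<dots> \<le> real (card (injective_tuples (P - {a}) n)) * exp (potential (x + v a) + B)"
      using Suc.IH[of "P - {a}" "\<theta> \<circ> Suc" "x + v a"] Suc.prems a E
      by (simp add: B_def E_def of_nat_diff o_def Suc_le_eq le_diff_conv)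
    finally show ?thesis .
  qed
  obtain a0 where a0: "a0 \<in> P" using P by auto
  define C where "C = real (card (injective_tuples (P - {a0}) n))"
  have C: "card (injective_tuples (P - {a}) n) = C" if "a \<in> P" for a
    using card_injective_tuples_Suc[OF P(3), of _ n] that a0 Suc.prems P(1)
    unfolding C_def by (metis Suc_le_lessD mult_cancel1 not_less0)
  have "(\<Sum>xs\<in>injective_tuples P (Suc n). exp (potential (x + deviation A \<theta> P xs))) \<le>
      (\<Sum>a\<in>P. C * exp (potential (x + v a) + B))"
    unfolding sum_injective_tuples_Suc[OF P(3)] using IH C by (intro sum_mono) auto
  also have "\<dots> = C * exp B * (\<Sum>a\<in>P. exp (potential (x + v a)))"
    by (simp add: exp_add sum_distrib_left mult_ac)
  \<comment> \<open>Averaging over the first draw comes last: the bound \<open>B\<close> for the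
    later draws is the same for every \<open>a\<close>.\<close>
  also have "\<dots> \<le> C * exp B * (real (card P) * exp (potential x + (\<bar>G\<bar> * norm u)\<^sup>2))"
    by (intro mult_left_mono sum_exp_potential_le sumv normv P) (auto simp: C_def)
  also have "\<dots> = real (card (injective_tuples P (Suc n))) *
      exp (potential x + (\<bar>G\<bar> * norm u)\<^sup>2 + B)"
    using card_injective_tuples_Suc[OF P(3) a0, of n] Suc.prems by (simp add: C_def exp_add mult_ac)
  also have "\<dots> \<le> real (card (injective_tuples P (Suc n))) *
      exp (potential x + G\<^sup>2 * (2 * (\<Sum>j<Suc n. (norm (\<theta> j))\<^sup>2) + 2 * real (Suc n - 1) * F / q))"
  proof (intro mult_left_mono)
    have "(\<bar>G\<bar> * norm u)\<^sup>2 + B \<le>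
        G\<^sup>2 * (2 * (norm (\<theta> 0))\<^sup>2 + 2 * (real n - real (n - 1)) * F / q) + B"
      using normu by (simp add: power_mult_distrib mult_left_mono)
    also have "\<dots> = G\<^sup>2 * (2 * (\<Sum>j<Suc n. (norm (\<theta> j))\<^sup>2) + 2 * real (Suc n - 1) * F / q)"
      using q by (simp add: B_def E_def sum.lessThan_Suc_shift field_simps del: sum.lessThan_Suc)
    finally show "exp (potential x + (\<bar>G\<bar> * norm u)\<^sup>2 + B) \<le>
      exp (potential x + G\<^sup>2 * (2 * (\<Sum>j<Suc n. (norm (\<theta> j))\<^sup>2) + 2 * real (Suc n - 1) * F / q))"
      by simp
  qed simp
  finally show ?case .
qed


section \<open>Tail bound for the deviation\<close>

lemma deviation_scaleR:
  "deviation (\<lambda>a u. l *\<^sub>R A a u) \<theta> P xs = l *\<^sub>R deviation A \<theta> P xs"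
  by (simp add: deviation_def mean_on_def scaleR_diff_right scaleR_left_commute flip: scaleR_sum_right)

text \<open>Chernoff's method in counting form. The parameter \<open>l\<close> is absorbed into the
  operators, which turns \<open>G\<close> into \<open>l * G\<close>; the summand 1 in the exponent
  is the potential at the origin.\<close>

lemma card_deviation_gt_le_exp:
  fixes A :: "'i \<Rightarrow> 'e::real_inner \<Rightarrow> 'a::real_inner"
  assumes lin: "\<And>a. linear (A a)" and P: "finite P" "n \<le> card P"
    and A: "\<And>a b u. a \<in> P \<Longrightarrow> b \<in> P \<Longrightarrow> norm (A a u - A b u) \<le> G * norm u"
    and N: "real N = real (card P) + 1" and K: "K = G * real N / (real N - real n) * sqrt (\<Sum>j<n. (norm (\<theta> j))\<^sup>2)"
    and l: "0 \<le> l"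
  shows "real (card {xs \<in> injective_tuples P n. t < norm (deviation A \<theta> P xs)}) * exp (l * t) \<le>
     real (card (injective_tuples P n)) * exp (1 + 2 * l\<^sup>2 * K\<^sup>2)"
proof -
  define T where "T = injective_tuples P n"
  define E where "E = (\<Sum>j<n. (norm (\<theta> j))\<^sup>2)"
  define q where "q = real N - real n"
  have q: "1 \<le> q" "q = real (card P) + 1 - real n" using N P by (auto simp: q_def)
  have E: "0 \<le> E" by (simp add: E_def sum_nonneg)
  have T: "finite T" using P by (simp add: T_def finite_injective_tuples)
  let ?bad = "{xs \<in> T. t < norm (deviation A \<theta> P xs)}"
  have "real (card ?bad) * exp (l * t) = (\<Sum>xs\<in>?bad. exp (l * t))" by simp
  also have "\<dots> \<le> (\<Sum>xs\<in>?bad. exp (potential (l *\<^sub>R deviation A \<theta> P xs)))"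
  proof (rule sum_mono)
    fix xs assume "xs \<in> ?bad"
    then have "l * t \<le> norm (l *\<^sub>R deviation A \<theta> P xs)"
      using l by (simp add: mult_left_mono)
    also have "\<dots> \<le> potential (l *\<^sub>R deviation A \<theta> P xs)" by (rule norm_le_potential)
    finally show "exp (l * t) \<le> exp (potential (l *\<^sub>R deviation A \<theta> P xs))" by simp
  qed
  also have "\<dots> \<le> (\<Sum>xs\<in>T. exp (potential (l *\<^sub>R deviation A \<theta> P xs)))"
    using T by (intro sum_mono2) auto
  also have "\<dots> = (\<Sum>xs\<in>T. exp (potential (0 + deviation (\<lambda>a u. l *\<^sub>R A a u) \<theta> P xs)))"
    by (simp add: deviation_scaleR)
  also have "\<dots> \<le> real (card T) *
      exp (potential (0::'a) + (l * G)\<^sup>2 * (2 * E + 2 * real (n - 1) * E / q))"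
    unfolding T_def E_def
  proof (rule sum_exp_potential_deviation_le)
    show "linear (\<lambda>u. l *\<^sub>R A a u)" for a using lin by (rule linear_compose_scale_right)
    show "norm (l *\<^sub>R A a u - l *\<^sub>R A b u) \<le> l * G * norm u" if "a \<in> P" "b \<in> P" for a b u
      using A[OF that, of u] l by (simp add: mult.assoc mult_left_mono flip: scaleR_diff_right)
  qed (use P q in auto)
  also have "\<dots> \<le> real (card T) * exp (1 + 2 * l\<^sup>2 * K\<^sup>2)"
  proof (intro mult_left_mono)
    \<comment> \<open>Since \<open>q\<close> is N - n, the factor is at most N/q, hence at most its
      square, which is the form needed for \<open>K\<^sup>2\<close>.\<close>
    have "2 * E + 2 * real (n - 1) * E / q = 2 * E * ((q + real (n - 1)) / q)"
      using q by (simp add: field_simps)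
    also have "\<dots> \<le> 2 * E * (N / q)\<^sup>2"
    proof (rule mult_left_mono)
      have "(q + real (n - 1)) / q \<le> N / q" using q by (intro divide_right_mono) (auto simp: q_def)
      moreover have "1 \<le> N / q" using q by (simp add: q_def le_divide_eq)
      then have "N / q \<le> (N / q)\<^sup>2" by (intro self_le_power) auto
      ultimately show "(q + real (n - 1)) / q \<le> (N / q)\<^sup>2" by linarith
    qed (use E in simp)
    finally have "(l * G)\<^sup>2 * (2 * E + 2 * real (n - 1) * E / q) \<le> (l * G)\<^sup>2 * (2 * E * (N / q)\<^sup>2)"
      by (rule mult_left_mono) simp
    also have "\<dots> = 2 * l\<^sup>2 * K\<^sup>2"
      using E by (simp add: K E_def[symmetric] q_def[symmetric] power_mult_distrib power_divide)
    finally show "exp (potential (0::'a) + (l * G)\<^sup>2 * (2 * E + 2 * real (n - 1) * E / q)) \<le>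
        exp (1 + 2 * l\<^sup>2 * K\<^sup>2)"
      by (simp add: potential_def)
  qed simp
  finally show ?thesis by (simp add: T_def)
qed

text \<open>With L = ln (exp 2 / \<delta>), the choice l = sqrt L / K makes the variance term 2 * L,
  while \<open>c0\<close> makes l * t at least 16 * L. This leaves at most exp (2 - L) =
  \<delta>.\<close>

lemma card_deviation_gt_le:
  fixes A :: "'i \<Rightarrow> 'e::real_inner \<Rightarrow> 'a::real_inner"
  assumes lin: "\<And>a. linear (A a)" and P: "finite P" "n \<le> card P"
    and A: "\<And>a b u. a \<in> P \<Longrightarrow> b \<in> P \<Longrightarrow> norm (A a u - A b u) \<le> G * norm u"
    and G: "0 \<le> G" and N: "real N = real (card P) + 1"
    and \<delta>: "0 < \<delta>" "\<delta> \<le> 1"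
  shows "real (card {xs \<in> injective_tuples P n. norm (deviation A \<theta> P xs) >
       G * real N / (real N - real n) * sqrt ((\<Sum>j<n. (norm (\<theta> j))\<^sup>2) * ln (exp 2 / \<delta>) / c0)}) \<le>
     \<delta> * real (card (injective_tuples P n))"
proof -
  define T where "T = injective_tuples P n"
  define E where "E = (\<Sum>j<n. (norm (\<theta> j))\<^sup>2)"
  define K where "K = G * real N / (real N - real n) * sqrt E"
  define L where "L = ln (exp 2 / \<delta>)"
  define D where "D xs = norm (deviation A \<theta> P xs)" for xs
  note exp_bound = card_deviation_gt_le_exp[where A = A, OF lin P A N K_def[unfolded E_def], folded T_def D_def]
  have T: "finite T" using P by (simp add: T_def finite_injective_tuples)
  have K: "0 \<le> K" using G N P by (auto simp: K_def E_def sum_nonneg)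
  have L: "2 \<le> L" "exp (- L) = \<delta> / exp 2"
    using \<delta> by (simp_all add: L_def ln_div exp_diff exp_minus)
  define t where "t = K * sqrt (L / c0)"
  have t: "t = G * real N / (real N - real n) * sqrt (E * L / c0)"
    by (simp add: t_def K_def real_sqrt_mult real_sqrt_divide)
  have "real (card {xs \<in> T. t < D xs}) \<le> \<delta> * real (card T)"
  proof (cases "K = 0")
    \<comment> \<open>The threshold is then 0, so every deviation must vanish. The exponential bound
      no longer grows with \<open>l\<close>, so a large \<open>l\<close> rules out a positive
      deviation.\<close>
    case True
    have "D xs = 0" if xs: "xs \<in> T" for xs
    proof (rule ccontr)
      assume "D xs \<noteq> 0"
      then have pos: "0 < D xs" by (simp add: D_def)
      \<comment> \<open>The parameter \<open>l = 2 * y / D xs\<close> at the level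
        \<open>D xs / 2\<close> makes the exponent \<open>y\<close>, and the bound becomes the
        impossible exp y \<le> y.\<close>
      define y where "y = real (card T) * exp 1"
      have "1 \<le> card {xs' \<in> T. D xs / 2 < D xs'}"
        using xs pos T by (simp add: Suc_le_eq card_gt_0_iff) (use xs in force)
      then have "exp y \<le> real (card {xs' \<in> T. D xs / 2 < D xs'}) * exp y" by simp
      also have "\<dots> \<le> y"
        using exp_bound[where l = "2 * y / D xs" and t = "D xs / 2"] pos True by (simp add: y_def)
      finally show False using exp_ge_add_one_self[of y] by linarith
    qed
    then have empty: "{xs \<in> T. t < D xs} = {}" using True by (auto simp: t_def)
    show ?thesis unfolding empty using \<delta> by simp
  next
    case False
    define l where "l = sqrt L / K"
    \<comment> \<open>The reciprocal of \<open>c0\<close> is 256 * e, which is at least 256.\<close>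
    have "16 = sqrt 256" by simp
    also have "\<dots> \<le> sqrt (1 / c0)"
      by (rule real_sqrt_le_mono) (simp add: c0_def exp_minus field_simps)
    finally have "16 * L \<le> L * sqrt (1 / c0)" using L by simp
    also have "\<dots> = l * t"
      using False L by (simp add: l_def t_def real_sqrt_divide flip: real_sqrt_mult)
    finally have lt: "16 * L \<le> l * t" .
    have "l\<^sup>2 * K\<^sup>2 = L" using False L by (simp add: l_def power_divide)
    then have "real (card {xs \<in> T. t < D xs}) * exp (l * t) \<le> real (card T) * exp (1 + 2 * L)"
      using exp_bound[where l = l and t = t] K L by (simp add: l_def mult.assoc)
    then have "real (card {xs \<in> T. t < D xs}) \<le> real (card T) * exp (1 + 2 * L - l * t)"
      by (simp add: exp_diff pos_le_divide_eq)
    also have "\<dots> \<le> real (card T) * exp (2 - L)"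
      using lt L by (intro mult_left_mono) auto
    also have "\<dots> = \<delta> * real (card T)" using L(2) by (simp add: exp_diff exp_minus field_simps)
    finally show ?thesis .
  qed
  then show ?thesis by (simp add: t T_def E_def L_def D_def)
qed

subsection \<open>Gaussian tails\<close>

declare transpose_matrix_vector [simp del]

lemma borel_measurable_matrix_vector_mult [measurable]:
  fixes A :: "real^'n^'m"
  assumes "f \<in> borel_measurable M"
  shows "(\<lambda>x. A *v f x) \<in> borel_measurable M"
  using assms
  by (rule borel_measurable_continuous_on[rotated]) (intro linear_continuous_on, simp)

section \<open>Matrices with orthonormal columns\<close>

lemma inner_transpose_matrix:
  fixes U :: "real^'d^'D"
  shows "(transpose U *v x) \<bullet> g = x \<bullet> (U *v g)"
  by (simp add: transpose_matrix_vector dot_lmul_matrix)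

lemma norm_orthonormal_columns:
  fixes U :: "real^'d^'D"
  assumes "transpose U ** U = mat 1"
  shows "norm (U *v g) = norm g"
  unfolding norm_eq_sqrt_inner inner_transpose_matrix[symmetric]
  by (simp add: matrix_vector_mul_assoc assms)

text \<open>Writing y for the image of x, adjointness gives |y|^2 = <x, U y> \<le> |x| |U y|, and
  \<open>U\<close> is an isometry.\<close>

lemma norm_transpose_orthonormal_columns_le:
  fixes U :: "real^'d^'D"
  assumes "transpose U ** U = mat 1"
  shows "norm (transpose U *v x) \<le> norm x"
proof -
  let ?y = "transpose U *v x"
  have "norm ?y * norm ?y = x \<bullet> (U *v ?y)"
    by (simp add: inner_transpose_matrix[symmetric] power2_norm_eq_inner[symmetric] power2_eq_square)
  also have "\<dots> \<le> norm x * norm ?y"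
    using norm_cauchy_schwarz[of x "U *v ?y"] by (simp add: norm_orthonormal_columns[OF assms])
  finally show ?thesis by (cases "?y = 0") auto
qed

section \<open>Gaussian integrals and moment generating functions\<close>

lemma nn_integral_translate:
  fixes f :: "'a::euclidean_space \<Rightarrow> ennreal"
  assumes [measurable]: "f \<in> borel_measurable borel"
  shows "(\<integral>\<^sup>+x. f (t + x) \<partial>lborel) = (\<integral>\<^sup>+x. f x \<partial>lborel)"
proof -
  have "(\<integral>\<^sup>+x. f x \<partial>lborel) = (\<integral>\<^sup>+x. f x \<partial>(distr lborel borel (\<lambda>x. t + x)))"
    using lborel_affine[of 1 t] by (simp add: density_1)
  also have "\<dots> = (\<integral>\<^sup>+x. f (t + x) \<partial>lborel)"
    by (subst nn_integral_distr) auto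
  finally show ?thesis by simp
qed

lemma nn_integral_exp_gauss_real:
  assumes "v > 0"
  shows "(\<integral>\<^sup>+x. ennreal (exp (- (x\<^sup>2 / (2 * v)))) \<partial>lborel) = ennreal (sqrt (2 * pi * v))"
proof -
  define s where "s = sqrt v"
  have s: "s > 0" "s\<^sup>2 = v" using assms by (auto simp: s_def)
  have "(\<integral>\<^sup>+x. ennreal (normal_density 0 s x) \<partial>lborel) = 1"
    using s by (subst nn_integral_eq_integral) (auto simp: integrable_normal_density)
  then have "ennreal (sqrt (2 * pi * v)) =
      ennreal (sqrt (2 * pi * v)) * (\<integral>\<^sup>+x. ennreal (normal_density 0 s x) \<partial>lborel)" by simp
  also have "\<dots> = (\<integral>\<^sup>+x. ennreal (sqrt (2 * pi * v)) * ennreal (normal_density 0 s x) \<partial>lborel)"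
    by (rule nn_integral_cmult[symmetric]) simp
  also have "\<dots> = (\<integral>\<^sup>+x. ennreal (exp (- (x\<^sup>2 / (2 * v)))) \<partial>lborel)"
    using assms s by (intro nn_integral_cong) (auto simp: normal_density_def simp flip: ennreal_mult)
  finally show ?thesis by simp
qed

lemma nn_integral_exp_gauss:
  assumes "v > 0"
  shows "(\<integral>\<^sup>+x. ennreal (exp (- ((norm x)\<^sup>2 / (2 * v)))) \<partial>(lborel :: 'a::euclidean_space measure)) =
     ennreal ((2 * pi * v) powr (real DIM('a) / 2))"
proof -
  have "exp (- ((norm x)\<^sup>2 / (2 * v))) = (\<Prod>b\<in>Basis. exp (- ((x \<bullet> b)\<^sup>2 / (2 * v))))" for x :: 'a
    unfolding power2_norm_eq_inner
    by (subst euclidean_inner)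
      (simp add: exp_sum[symmetric] sum_negf sum_divide_distrib power2_eq_square)
  then have "(\<integral>\<^sup>+x. ennreal (exp (- ((norm x)\<^sup>2 / (2 * v)))) \<partial>(lborel :: 'a measure)) =
      (\<integral>\<^sup>+x. (\<Prod>b\<in>Basis. ennreal (exp (- ((x \<bullet> b)\<^sup>2 / (2 * v))))) \<partial>(lborel :: 'a measure))"
    by (simp add: prod_ennreal)
  also have "\<dots> = (\<Prod>b\<in>(Basis::'a set). (\<integral>\<^sup>+x. ennreal (exp (- (x\<^sup>2 / (2 * v)))) \<partial>lborel))"
    by (rule nn_integral_lborel_prod) auto
  also have "\<dots> = ennreal (sqrt (2 * pi * v)) ^ DIM('a)"
    using assms by (simp add: nn_integral_exp_gauss_real)
  also have "\<dots> = ennreal (sqrt (2 * pi * v) ^ DIM('a))"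
    using assms by (simp add: ennreal_power)
  also have "sqrt (2 * pi * v) ^ DIM('a) = (2 * pi * v) powr (real DIM('a) / 2)"
    using assms by (simp add: powr_half_sqrt[symmetric] powr_powr flip: powr_realpow)
  finally show ?thesis .
qed

lemma nn_integral_exp_inner_gauss:
  fixes a :: "'a::euclidean_space"
  assumes "v > 0"
  shows "(\<integral>\<^sup>+x. ennreal (exp (a \<bullet> x) * exp (- ((norm x)\<^sup>2 / (2 * v)))) \<partial>lborel) =
     ennreal (exp (v * (norm a)\<^sup>2 / 2) * (2 * pi * v) powr (real DIM('a) / 2))"
proof -
  \<comment> \<open>Translating by \<open>v *\<^sub>R a\<close> completes the square.\<close>
  have "(\<integral>\<^sup>+x. ennreal (exp (a \<bullet> x) * exp (- ((norm x)\<^sup>2 / (2 * v)))) \<partial>lborel) =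
      (\<integral>\<^sup>+x. ennreal (exp (a \<bullet> (v *\<^sub>R a + x)) * exp (- ((norm (v *\<^sub>R a + x))\<^sup>2 / (2 * v)))) \<partial>lborel)"
    by (rule nn_integral_translate[symmetric]) measurable
  also have "\<dots> = (\<integral>\<^sup>+x. ennreal (exp (v * (norm a)\<^sup>2 / 2)) *
      ennreal (exp (- ((norm x)\<^sup>2 / (2 * v)))) \<partial>(lborel :: 'a measure))"
  proof (intro nn_integral_cong)
    fix x :: 'a
    have "a \<bullet> (v *\<^sub>R a + x) + - ((norm (v *\<^sub>R a + x))\<^sup>2 / (2 * v)) =
        v * (norm a)\<^sup>2 / 2 + - ((norm x)\<^sup>2 / (2 * v))"
      using assms unfolding power2_norm_eq_inner
      by (simp add: inner_add inner_commute field_simps power2_eq_square)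
    then show "ennreal (exp (a \<bullet> (v *\<^sub>R a + x)) * exp (- ((norm (v *\<^sub>R a + x))\<^sup>2 / (2 * v)))) =
        ennreal (exp (v * (norm a)\<^sup>2 / 2)) * ennreal (exp (- ((norm x)\<^sup>2 / (2 * v))))"
      by (simp add: exp_add[symmetric] ennreal_mult[symmetric])
  qed
  also have "\<dots> = ennreal (exp (v * (norm a)\<^sup>2 / 2) * (2 * pi * v) powr (real DIM('a) / 2))"
    using assms by (simp add: nn_integral_cmult nn_integral_exp_gauss ennreal_mult)
  finally show ?thesis .
qed

lemma nn_integral_gaussian_vec:
  fixes f :: "real^'D \<Rightarrow> real"
  assumes "\<sigma> > 0" and [measurable]: "f \<in> borel_measurable borel" and "\<And>x. 0 \<le> f x"
  shows "(\<integral>\<^sup>+x. ennreal (f x) \<partial>gaussian_vec \<sigma>) =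
     ennreal ((2 * pi * \<sigma>\<^sup>2) powr (- real CARD('D) / 2)) *
     (\<integral>\<^sup>+x. ennreal (f x * exp (- ((norm x)\<^sup>2 / (2 * \<sigma>\<^sup>2)))) \<partial>lborel)"
proof -
  have "(\<integral>\<^sup>+x. ennreal (f x) \<partial>gaussian_vec \<sigma>) = (\<integral>\<^sup>+x. ennreal ((2 * pi * \<sigma>\<^sup>2) powr (- real CARD('D) / 2)) *
     ennreal (f x * exp (- ((norm x)\<^sup>2 / (2 * \<sigma>\<^sup>2)))) \<partial>lborel)"
    unfolding gaussian_vec_def using assms
    by (subst nn_integral_density)
      (auto intro!: nn_integral_cong simp: mult_ac simp flip: ennreal_mult)
  also have "\<dots> = ennreal ((2 * pi * \<sigma>\<^sup>2) powr (- real CARD('D) / 2)) *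
     (\<integral>\<^sup>+x. ennreal (f x * exp (- ((norm x)\<^sup>2 / (2 * \<sigma>\<^sup>2)))) \<partial>lborel)"
    by (rule nn_integral_cmult) measurable
  finally show ?thesis .
qed

lemma sets_gaussian_vec [simp, measurable_cong]: "sets (gaussian_vec \<sigma>) = sets borel"
  and space_gaussian_vec [simp]: "space (gaussian_vec \<sigma>) = UNIV"
  by (simp_all add: gaussian_vec_def)

lemma nn_integral_exp_inner_gaussian_vec:
  fixes a :: "real^'D"
  assumes "\<sigma> > 0"
  shows "(\<integral>\<^sup>+x. ennreal (exp (a \<bullet> x)) \<partial>gaussian_vec \<sigma>) = ennreal (exp (\<sigma>\<^sup>2 * (norm a)\<^sup>2 / 2))"
proof -
  have "(\<integral>\<^sup>+x. ennreal (exp (a \<bullet> x)) \<partial>gaussian_vec \<sigma>) =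
      ennreal ((2 * pi * \<sigma>\<^sup>2) powr (- real CARD('D) / 2)) *
      ennreal (exp (\<sigma>\<^sup>2 * (norm a)\<^sup>2 / 2) * (2 * pi * \<sigma>\<^sup>2) powr (real CARD('D) / 2))"
    using assms by (subst nn_integral_gaussian_vec) (simp_all add: nn_integral_exp_inner_gauss)
  also have "\<dots> = ennreal (exp (\<sigma>\<^sup>2 * (norm a)\<^sup>2 / 2))"
    using assms by (simp add: powr_minus field_simps flip: ennreal_mult)
  finally show ?thesis .
qed

lemma prob_space_gaussian_vec:
  assumes "\<sigma> > 0"
  shows "prob_space (gaussian_vec \<sigma> :: (real^'D) measure)"
proof
  show "emeasure (gaussian_vec \<sigma> :: (real^'D) measure) (space (gaussian_vec \<sigma>)) = 1"
    \<comment> \<open>The total mass is the moment generating function at the origin.\<close>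
    using nn_integral_exp_inner_gaussian_vec[OF assms, of "0::real^'D"]
    by simp
qed

text \<open>Writing exp(c |u|^2) as a Gaussian average of exp(u . g) over g in R^d and exchanging the two
  integrals reduces this to moment generating functions, so that neither rotation invariance nor a
  marginal density is needed.\<close>

lemma nn_integral_exp_norm2_transpose_gaussian_vec:
  fixes U :: "real^'d^'D"
  assumes \<sigma>: "\<sigma> > 0" and U: "transpose U ** U = mat 1" and s: "0 < s" "s < 1/2"
  shows "(\<integral>\<^sup>+x. ennreal (exp (s / \<sigma>\<^sup>2 * (norm (transpose U *v x))\<^sup>2)) \<partial>gaussian_vec \<sigma>) =
     ennreal ((1 - 2 * s) powr (- real CARD('d) / 2))"
proof -
  \<comment> \<open>Variance of the auxiliary Gaussian \<open>g\<close>: it makes v * |u|^2 / 2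
    equal to the required exponent s / \<sigma>^2 * |u|^2.\<close>
  define v where "v = 2 * s / \<sigma>\<^sup>2"
  have v: "v > 0" using \<sigma> s by (simp add: v_def)
  define C where "C = (2 * pi * v) powr (- real CARD('d) / 2)"
  interpret prob_space "gaussian_vec \<sigma> :: (real^'D) measure" by (rule prob_space_gaussian_vec[OF \<sigma>])
  interpret pair_sigma_finite "gaussian_vec \<sigma> :: (real^'D) measure" "lborel :: (real^'d) measure" ..
  have "continuous_on UNIV (\<lambda>p::(real^'D) \<times> (real^'d).
      exp ((U *v snd p) \<bullet> fst p) * exp (- ((norm (snd p))\<^sup>2 / (2 * v))))"
    using v by (intro continuous_intros linear_continuous_on_compose[OF continuous_on_snd]) auto
  then have "(\<lambda>p::(real^'D) \<times> (real^'d).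
      exp ((U *v snd p) \<bullet> fst p) * exp (- ((norm (snd p))\<^sup>2 / (2 * v)))) \<in> borel_measurable borel"
    by (rule borel_measurable_continuous_onI)
  moreover have "sets (gaussian_vec \<sigma> \<Otimes>\<^sub>M lborel) = sets (borel :: ((real^'D) \<times> (real^'d)) measure)"
    by (simp cong: sets_pair_measure_cong flip: borel_prod)
  ultimately have meas: "(\<lambda>(x, g). ennreal (exp ((U *v g) \<bullet> x) * exp (- ((norm g)\<^sup>2 / (2 * v))))) \<in>
      borel_measurable ((gaussian_vec \<sigma> :: (real^'D) measure) \<Otimes>\<^sub>M lborel)"
    by (simp add: case_prod_beta cong: measurable_cong_sets)
  have CQ: "C * (2 * pi * v) powr (real CARD('d) / 2) = 1"
    using v by (simp add: C_def powr_minus)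
  have "ennreal (exp (s / \<sigma>\<^sup>2 * (norm (transpose U *v x))\<^sup>2)) =
      ennreal C * (\<integral>\<^sup>+g. ennreal (exp ((U *v g) \<bullet> x) * exp (- ((norm g)\<^sup>2 / (2 * v)))) \<partial>lborel)" for x
  proof -
    have "exp (s / \<sigma>\<^sup>2 * (norm (transpose U *v x))\<^sup>2) =
        C * (exp (v * (norm (transpose U *v x))\<^sup>2 / 2) * (2 * pi * v) powr (real CARD('d) / 2))"
      using CQ by (simp add: v_def mult.left_commute[of C])
    moreover have "(U *v g) \<bullet> x = (transpose U *v x) \<bullet> g" for g
      by (metis inner_transpose_matrix inner_commute)
    moreover have "0 \<le> C" by (simp add: C_def)
    ultimately show ?thesis
      by (simp add: nn_integral_exp_inner_gauss[OF v] flip: ennreal_mult)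
  qed
  then have "(\<integral>\<^sup>+x. ennreal (exp (s / \<sigma>\<^sup>2 * (norm (transpose U *v x))\<^sup>2)) \<partial>gaussian_vec \<sigma>) =
      (\<integral>\<^sup>+x. ennreal C * (\<integral>\<^sup>+g. ennreal (exp ((U *v g) \<bullet> x) * exp (- ((norm g)\<^sup>2 / (2 * v)))) \<partial>lborel)
        \<partial>gaussian_vec \<sigma>)"
    by simp
  also have "\<dots> = ennreal C * (\<integral>\<^sup>+x. (\<integral>\<^sup>+g. ennreal (exp ((U *v g) \<bullet> x) * exp (- ((norm g)\<^sup>2 / (2 * v)))) \<partial>lborel)
        \<partial>gaussian_vec \<sigma>)"
    by (rule nn_integral_cmult) measurable
  also have "\<dots> = ennreal C * (\<integral>\<^sup>+g. (\<integral>\<^sup>+x. ennreal (exp ((U *v g) \<bullet> x) * exp (- ((norm g)\<^sup>2 / (2 * v))))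
        \<partial>gaussian_vec \<sigma>) \<partial>lborel)"
    using Fubini'[OF meas] by simp
  also have "\<dots> = ennreal C * (\<integral>\<^sup>+g. ennreal (exp (- ((norm g)\<^sup>2 / (2 * (v / (1 - 2 * s)))))) \<partial>(lborel :: (real^'d) measure))"
  proof (intro arg_cong[where f = "(*) (ennreal C)"] nn_integral_cong)
    fix g :: "real^'d"
    have "(\<integral>\<^sup>+x. ennreal (exp ((U *v g) \<bullet> x) * exp (- ((norm g)\<^sup>2 / (2 * v)))) \<partial>gaussian_vec \<sigma>) =
        (\<integral>\<^sup>+x. ennreal (exp ((U *v g) \<bullet> x)) \<partial>gaussian_vec \<sigma>) * ennreal (exp (- ((norm g)\<^sup>2 / (2 * v))))"
      by (subst nn_integral_multc[symmetric]) (auto simp: ennreal_mult)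
    also have "\<dots> = ennreal (exp (\<sigma>\<^sup>2 * (norm g)\<^sup>2 / 2 + - ((norm g)\<^sup>2 / (2 * v))))"
      using nn_integral_exp_inner_gaussian_vec[OF \<sigma>, of "U *v g"]
      by (simp add: norm_orthonormal_columns[OF U] flip: exp_add ennreal_mult)
    \<comment> \<open>Integrating out \<open>x\<close> raises the variance of \<open>g\<close> from
      v to v / (1 - 2s); this stays positive because s < 1/2.\<close>
    also have "\<sigma>\<^sup>2 * (norm g)\<^sup>2 / 2 + - ((norm g)\<^sup>2 / (2 * v)) = - ((norm g)\<^sup>2 / (2 * (v / (1 - 2 * s))))"
      using \<sigma> s by (simp add: v_def field_simps)
    finally show "(\<integral>\<^sup>+x. ennreal (exp ((U *v g) \<bullet> x) * exp (- ((norm g)\<^sup>2 / (2 * v)))) \<partial>gaussian_vec \<sigma>) =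
        ennreal (exp (- ((norm g)\<^sup>2 / (2 * (v / (1 - 2 * s))))))" .
  qed
  also have "\<dots> = ennreal (C * (2 * pi * (v / (1 - 2 * s))) powr (real CARD('d) / 2))"
    using v s by (subst nn_integral_exp_gauss) (auto simp: C_def ennreal_mult)
  also have "C * (2 * pi * (v / (1 - 2 * s))) powr (real CARD('d) / 2) =
      (1 - 2 * s) powr (- real CARD('d) / 2)"
    using v s by (simp add: C_def powr_minus powr_mult powr_divide field_simps)
  finally show ?thesis .
qed

section \<open>Chi-square tail\<close>

text \<open>The inequality x \<le> sinh x at x = ln w.\<close>

lemma ln_le_half_diff_inverse:
  fixes w :: real
  assumes "1 \<le> w"
  shows "ln w \<le> (w - 1 / w) / 2"
  using real_le_x_sinh[of "ln w"] assms by (simp add: field_simps)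

text \<open>Markov's inequality for the exponential moment of the squared norm; bounding the
  logarithm by a rational function reduces the exponent to algebra.\<close>

lemma gaussian_vec_norm_transpose_tail:
  fixes U :: "real^'d^'D"
  assumes \<sigma>: "\<sigma> > 0" and U: "transpose U ** U = mat 1" and l: "l > 0"
  defines "d \<equiv> real CARD('d)"
  shows "measure (gaussian_vec \<sigma>)
      {x. norm (transpose U *v x) > \<sigma> * sqrt (d + 2 * l + 2 * sqrt (d * l))} \<le> exp (- l)"
proof -
  \<comment> \<open>w makes the Chernoff exponent with parameter s equal to -l after the bound on ln w.\<close>
  define w where "w = 1 + 2 * sqrt (l / d)"
  define s where "s = (1 - 1 / w) / 2"
  define R where "R = d + 2 * l + 2 * sqrt (d * l)"
  have d: "0 < d" by (simp add: d_def)
  have w: "1 < w" using l d by (simp add: w_def)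
  have s: "0 < s" "s < 1/2" "1 - 2 * s = 1 / w" using w by (auto simp: s_def field_simps)
  have R: "0 \<le> R" using l d by (simp add: R_def)
  interpret prob_space "gaussian_vec \<sigma> :: (real^'D) measure" by (rule prob_space_gaussian_vec[OF \<sigma>])
  let ?f = "\<lambda>x. exp (s / \<sigma>\<^sup>2 * (norm (transpose U *v x))\<^sup>2)"
  have "emeasure (gaussian_vec \<sigma>) {x. norm (transpose U *v x) > \<sigma> * sqrt R} \<le>
      emeasure (gaussian_vec \<sigma>) {x \<in> space (gaussian_vec \<sigma>). 1 \<le> ennreal (exp (- s * R)) * ennreal (?f x)}"
  proof (rule emeasure_mono)
    show "{x. norm (transpose U *v x) > \<sigma> * sqrt R} \<subseteq>
      {x \<in> space (gaussian_vec \<sigma>). 1 \<le> ennreal (exp (- s * R)) * ennreal (?f x)}"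
    proof safe
      fix x assume x: "\<sigma> * sqrt R < norm (transpose U *v x)"
      have "(\<sigma> * sqrt R)\<^sup>2 \<le> (norm (transpose U *v x))\<^sup>2"
        using x \<sigma> R by (intro power_mono) auto
      then have "R \<le> (norm (transpose U *v x))\<^sup>2 / \<sigma>\<^sup>2"
        using \<sigma> R by (simp add: power_mult_distrib field_simps)
      then have "s * R \<le> s * ((norm (transpose U *v x))\<^sup>2 / \<sigma>\<^sup>2)"
        using s by (intro mult_left_mono) auto
      then have "1 \<le> exp (- s * R) * ?f x" by (simp flip: exp_add)
      then show "1 \<le> ennreal (exp (- s * R)) * ennreal (?f x)"
        by (simp flip: ennreal_mult)
    qed simp
  qed measurable
  also have "\<dots> \<le> ennreal (exp (- s * R)) * (\<integral>\<^sup>+x. ennreal (?f x) * indicator (space (gaussian_vec \<sigma>)) x \<partial>gaussian_vec \<sigma>)"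
    by (rule nn_integral_Markov_inequality) auto
  also have "\<dots> = ennreal (exp (- s * R) * (1 - 2 * s) powr (- d / 2))"
    using nn_integral_exp_norm2_transpose_gaussian_vec[OF \<sigma> U s(1,2)]
    by (simp add: ennreal_mult d_def)
  also have "\<dots> \<le> ennreal (exp (- l))"
  proof (rule ennreal_leI)
    have "exp (- s * R) * (1 - 2 * s) powr (- d / 2) = exp (- s * R + d / 2 * ln w)"
      using w by (simp add: s(3) powr_def ln_div flip: exp_add)
    also have "\<dots> \<le> exp (- s * R + d / 2 * ((w - 1 / w) / 2))"
      using ln_le_half_diff_inverse[of w] w d by simp
    also have "- s * R + d / 2 * ((w - 1 / w) / 2) = - l"
    proof -
      define r where "r = sqrt (l / d)"
      have r: "r > 0" "l = d * r\<^sup>2" using l d by (auto simp: r_def)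
      have "sqrt (d * l) = d * r" using r d by (simp add: real_sqrt_mult power2_eq_square[symmetric] flip: mult.assoc)
      then have R': "R = d * (1 + 2 * r\<^sup>2 + 2 * r)" by (simp add: R_def r(2) algebra_simps)
      have w': "w = 1 + 2 * r" by (simp add: w_def r_def)
      have "- s * R + d / 2 * ((w - 1 / w) / 2) =
          d * (w * w - 1 - 2 * (w - 1) * (1 + 2 * r\<^sup>2 + 2 * r)) / (4 * w)"
        unfolding R' s_def using w by (simp add: field_simps)
      \<comment> \<open>The factor \<open>w\<close> splits off because w = 1 + 2r, and it cancels
        the denominator.\<close>
      also have "w * w - 1 - 2 * (w - 1) * (1 + 2 * r\<^sup>2 + 2 * r) = - (4 * r\<^sup>2) * w"
        unfolding w' by (simp add: algebra_simps power2_eq_square)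
      also have "d * (- (4 * r\<^sup>2) * w) / (4 * w) = - l" using w by (simp add: r(2))
      finally show ?thesis .
    qed
    finally show "exp (- s * R) * (1 - 2 * s) powr (- d / 2) \<le> exp (- l)" .
  qed
  finally show ?thesis by (simp add: emeasure_eq_measure R_def)
qed

subsection \<open>Coherence and the union bound\<close>

lemma subspace_coherence_ge:
  assumes "w \<in> S" "z \<in> T"
  shows "\<bar>w \<bullet> z\<bar> \<le> subspace_coherence S T * (norm w * norm z)"
proof (cases "w = 0 \<or> z = 0")
  case False
  let ?Q = "{\<bar>w \<bullet> z\<bar> / (norm w * norm z) | w z. w \<in> S \<and> z \<in> T \<and> w \<noteq> 0 \<and> z \<noteq> 0}"
  have "bdd_above ?Q"
    by (rule bdd_aboveI[of _ 1]) (auto simp: divide_le_eq Cauchy_Schwarz_ineq2)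
  then have "\<bar>w \<bullet> z\<bar> / (norm w * norm z) \<le> subspace_coherence S T"
    unfolding subspace_coherence_def using assms False by (intro cSup_upper) auto
  then show ?thesis using False by (simp add: divide_le_eq)
qed auto

text \<open>With h the image of g, test the coherence on \<open>U *v h\<close> and
  \<open>V *v g\<close>: their inner product is |h|^2 and their norms are |h| and |g|.\<close>

lemma norm_transpose_mult_le_coherence:
  fixes U V :: "real^'d^'D"
  assumes "transpose U ** U = mat 1" "transpose V ** V = mat 1"
  shows "norm ((transpose U ** V) *v g) \<le>
    subspace_coherence (subspace_of U) (subspace_of V) * norm g"
proof -
  define h where "h = (transpose U ** V) *v g"
  have "(norm h)\<^sup>2 = (transpose U *v (V *v g)) \<bullet> h"
    by (simp add: h_def power2_norm_eq_inner matrix_vector_mul_assoc)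
  also have "\<dots> = (U *v h) \<bullet> (V *v g)"
    by (metis inner_transpose_matrix inner_commute)
  also have "\<dots> \<le> subspace_coherence (subspace_of U) (subspace_of V) * (norm (U *v h) * norm (V *v g))"
    using subspace_coherence_ge[of "U *v h" "subspace_of U" "V *v g" "subspace_of V"]
    by (auto simp: subspace_of_def)
  also have "\<dots> = (subspace_coherence (subspace_of U) (subspace_of V) * norm g) * norm h"
    using assms by (simp add: norm_orthonormal_columns)
  finally have *: "norm h * norm h \<le> \<dots>" by (simp add: power2_eq_square)
  show ?thesis
  proof (cases "h = 0")
    case True
    \<comment> \<open>A supremum of nonnegative quotients needs a witness to be known nonnegative;
      for nonzero \<open>g\<close> the pair \<open>U *v g\<close>, \<open>V *v g\<close> is
      one.\<close>
    have "0 \<le> subspace_coherence (subspace_of U) (subspace_of V) * norm g"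
    proof -
      have "0 \<le> \<bar>(U *v g) \<bullet> (V *v g)\<bar>" by simp
      also have "\<dots> \<le> subspace_coherence (subspace_of U) (subspace_of V) * (norm g * norm g)"
        using subspace_coherence_ge[of "U *v g" "subspace_of U" "V *v g" "subspace_of V"] assms
        by (auto simp: subspace_of_def norm_orthonormal_columns)
      finally show ?thesis by (cases "g = 0") (auto simp: zero_le_mult_iff power2_eq_square[symmetric])
    qed
    then show ?thesis using True by (simp add: h_def)
  next
    case False
    with * show ?thesis by (simp add: h_def)
  qed
qed

lemma local_2_coherence_ge:
  assumes "j < N" "l < N" "j \<noteq> k" "l \<noteq> k" "j \<noteq> l"
  shows "subspace_coherence (subspace_of (Phi k)) (subspace_of (Phi j))
    + subspace_coherence (subspace_of (Phi k)) (subspace_of (Phi l)) \<le> local_2_coherence N Phi k"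
proof -
  let ?f = "\<lambda>j l. subspace_coherence (subspace_of (Phi k)) (subspace_of (Phi j))
    + subspace_coherence (subspace_of (Phi k)) (subspace_of (Phi l))"
  have "finite {?f j l | j l. j < N \<and> l < N \<and> j \<noteq> k \<and> l \<noteq> k \<and> j \<noteq> l}"
    by (rule finite_subset[of _ "case_prod ?f ` ({..<N} \<times> {..<N})"]) auto
  then show ?thesis unfolding local_2_coherence_def using assms by (intro Max_ge) auto
qed

lemma sum_matrix_vector_mult: "(\<Sum>j\<in>I. M j) *v (x :: real^'n) = (\<Sum>j\<in>I. M j *v x)"
  by (induction I rule: infinite_finite_induct) (simp_all add: matrix_vector_mult_add_rdistrib)

abbreviation gram :: "(nat \<Rightarrow> real^'d^'D) \<Rightarrow> nat \<Rightarrow> nat \<Rightarrow> real^'d \<Rightarrow> real^'d" where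
  "gram Phi k a \<equiv> (*v) (transpose (Phi k) ** Phi a)"

text \<open>Controls the conditional mean of the projected signal for inactive \<open>k\<close>: an
  operator norm times |\<Sum> theta|, which Cauchy-Schwarz bounds by the root of n times the
  energy.\<close>

lemma norm_mean_gram_le:
  fixes theta :: "nat \<Rightarrow> real^'d"
  assumes "k < N" "N \<ge> 2"
  shows "norm (mean_on ({0..<N} - {k}) (\<lambda>a. gram Phi k a (\<Sum>j<n. theta j))) \<le>
    avg_mixing_coherence N Phi k * sqrt (real n * energy n theta)"
proof -
  let ?s = "\<Sum>j<n. theta j" and ?M = "\<Sum>j\<in>{0..<N} - {k}. transpose (Phi k) ** Phi j"
  have card: "real (card ({0..<N} - {k})) = real N - 1" using assms by (simp add: of_nat_diff)
  have "norm (mean_on ({0..<N} - {k}) (\<lambda>a. gram Phi k a ?s)) = norm (?M *v ?s) / (real N - 1)"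
    unfolding mean_on_def card using assms by (simp add: sum_matrix_vector_mult field_simps)
  also have "\<dots> \<le> (onorm ((*v) ?M) * norm ?s) / (real N - 1)"
    using assms by (intro divide_right_mono onorm) auto
  also have "\<dots> \<le> (onorm ((*v) ?M) * sqrt (real n * energy n theta)) / (real N - 1)"
  proof (intro divide_right_mono mult_left_mono)
    show "norm ?s \<le> sqrt (real n * energy n theta)"
      unfolding energy_def by (rule real_le_rsqrt) (rule norm_sum_power2_le)
  qed (use assms in \<open>auto intro: onorm_pos_le\<close>)
  finally show ?thesis by (simp add: avg_mixing_coherence_def)
qed

section \<open>The exceptional activity patterns\<close>

text \<open>The last summand of the thresholds: \<delta> is \<alpha> / N for bounded noise and
  \<alpha> / (2N) for Gaussian noise.\<close>

definition deviation_bound ::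
  "nat \<Rightarrow> nat \<Rightarrow> (nat \<Rightarrow> real^'d^'D) \<Rightarrow> (nat \<Rightarrow> real^'d) \<Rightarrow> real \<Rightarrow> nat \<Rightarrow> real" where
  "deviation_bound N n Phi theta \<delta> k = local_2_coherence N Phi k * real N / (real N - real n)
     * sqrt (energy n theta * ln (exp 2 / \<delta>) / c0)"

definition outlying ::
  "nat \<Rightarrow> nat \<Rightarrow> (nat \<Rightarrow> real^'d^'D) \<Rightarrow> (nat \<Rightarrow> real^'d) \<Rightarrow> real \<Rightarrow> nat list set" where
  "outlying N n Phi theta \<delta> = {xs. \<exists>k<N. k \<notin> set xs \<and>
     deviation_bound N n Phi theta \<delta> k < norm (deviation (gram Phi k) theta ({0..<N} - {k}) xs)}"

lemma tuples_eq: "tuples N n = injective_tuples {0..<N} n"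
  by (simp add: tuples_def injective_tuples_def)

lemma tuples_finite_nonempty:
  assumes "n \<le> N"
  shows "finite (tuples N n)" "tuples N n \<noteq> {}"
proof -
  show "finite (tuples N n)" by (simp add: tuples_eq finite_injective_tuples)
  have "[0..<n] \<in> tuples N n" using assms by (auto simp: tuples_def)
  then show "tuples N n \<noteq> {}" by auto
qed

text \<open>Union bound over \<open>k\<close>. Tuples avoiding \<open>k\<close> are tuples over the
  other N - 1 indices and are at most as many as all tuples, so the conditional bound \<delta> also
  holds without conditioning. The null set of non-tuples is added so that later inclusions hold for
  all lists.\<close>

lemma prob_outlying_le:
  fixes Phi :: "nat \<Rightarrow> real^'d^'D"
  assumes N: "N \<ge> 3" "n < N"
    and Phi: "\<And>i. i < N \<Longrightarrow> transpose (Phi i) ** Phi i = mat 1"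
    and \<delta>: "0 < \<delta>" "\<delta> \<le> 1"
  shows "measure_pmf.prob (pmf_of_set (tuples N n)) (outlying N n Phi theta \<delta> \<union> - tuples N n) \<le> N * \<delta>"
proof -
  define bad where "bad k = {xs \<in> injective_tuples ({0..<N} - {k}) n. deviation_bound N n Phi theta \<delta> k
     < norm (deviation (gram Phi k) theta ({0..<N} - {k}) xs)}" for k
  have fin: "finite (tuples N n)" "tuples N n \<noteq> {}" using N tuples_finite_nonempty by auto
  have bad: "real (card (bad k)) \<le> \<delta> * real (card (tuples N n))" if k: "k < N" for k
  proof -
    let ?P = "{0..<N} - {k}" and ?G = "local_2_coherence N Phi k"
    \<comment> \<open>The triangle inequality produces the sum of two coherences with distinct
      indices, which is why the local 2-subspace coherence enters.\<close>
    have diff: "norm (gram Phi k a u - gram Phi k b u) \<le> ?G * norm u"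
      if ab: "a \<in> ?P" "b \<in> ?P" "a \<noteq> b" for a b u
    proof -
      have "norm (gram Phi k a u - gram Phi k b u) \<le> norm (gram Phi k a u) + norm (gram Phi k b u)"
        by (rule norm_triangle_ineq4)
      also have "\<dots> \<le> (subspace_coherence (subspace_of (Phi k)) (subspace_of (Phi a))
          + subspace_coherence (subspace_of (Phi k)) (subspace_of (Phi b))) * norm u"
        unfolding distrib_right using ab k
        by (intro add_mono norm_transpose_mult_le_coherence Phi) auto
      also have "\<dots> \<le> ?G * norm u"
        using ab by (intro mult_right_mono local_2_coherence_ge) auto
      finally show ?thesis .
    qed
    have card: "card ?P = N - 1" using k by simp
    \<comment> \<open>N \<ge> 3 leaves two distinct indices besides \<open>k\<close>; any nonzero
      vector then shows that the 2-coherence is nonnegative.\<close>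
    obtain a b where ab: "a \<in> ?P" "b \<in> ?P" "a \<noteq> b"
      using N card by (metis One_nat_def card_le_Suc0_iff_eq finite_Diff finite_atLeastLessThan
          diff_le_mono not_less_eq_eq numeral_3_eq_3 diff_Suc_1)
    have "0 \<le> ?G * norm (axis undefined 1 :: real^'d)"
      using diff[OF ab, of "axis undefined 1"] norm_ge_zero order_trans by blast
    then have G: "0 \<le> ?G" by simp
    have "real (card (bad k)) \<le> \<delta> * real (card (injective_tuples ?P n))"
      unfolding bad_def deviation_bound_def energy_def
    proof (rule card_deviation_gt_le)
      show "norm (gram Phi k a u - gram Phi k b u) \<le> ?G * norm u"
        if "a \<in> ?P" "b \<in> ?P" for a b u
        using diff[OF that] G by (cases "a = b") auto
      show "real N = real (card ?P) + 1" using N k by (simp add: of_nat_diff)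
      show "n \<le> card ?P" using card N by simp
    qed (use G \<delta> in auto)
    also have "\<dots> \<le> \<delta> * real (card (tuples N n))"
      using \<delta> fin by (intro mult_left_mono of_nat_mono card_mono)
        (auto simp: tuples_eq injective_tuples_def)
    finally show ?thesis .
  qed
  have "tuples N n \<inter> (outlying N n Phi theta \<delta> \<union> - tuples N n) \<subseteq> (\<Union>k<N. bad k)"
    unfolding outlying_def bad_def tuples_eq injective_tuples_def by fastforce
  then have "real (card (tuples N n \<inter> (outlying N n Phi theta \<delta> \<union> - tuples N n))) \<le>
      real (card (\<Union>k<N. bad k))"
    by (intro of_nat_mono card_mono) (auto simp: bad_def finite_injective_tuples)
  also have "\<dots> \<le> real (\<Sum>k<N. card (bad k))"
    by (intro of_nat_mono card_UN_le) auto
  also have "\<dots> \<le> (\<Sum>k<N. \<delta> * real (card (tuples N n)))"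
    unfolding of_nat_sum using bad by (intro sum_mono) auto
  also have "\<dots> = N * \<delta> * real (card (tuples N n))" by simp
  finally show ?thesis
    using fin by (simp add: measure_pmf_of_set divide_le_eq card_gt_0_iff)
qed

text \<open>The deterministic core, shared by both noise models: for inactive \<open>k\<close> the
  projected observation is deviation plus mean plus projected noise, and the threshold is the
  squared sum of their bounds.\<close>

lemma msd_estimate_subset:
  fixes Phi :: "nat \<Rightarrow> real^'d^'D"
  assumes N: "N \<ge> 2" and xs: "xs \<in> tuples N n" "xs \<notin> outlying N n Phi theta \<delta>"
    and \<eta>: "\<And>k. k < N \<Longrightarrow> norm (transpose (Phi k) *v \<eta>) \<le> e"
    and \<tau>: "\<And>k. \<tau> k = (e + avg_mixing_coherence N Phi k * sqrt (real n * energy n theta)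
      + deviation_bound N n Phi theta \<delta> k)\<^sup>2"
  shows "msd_estimate N Phi \<tau> (signal Phi theta xs + \<eta>) \<subseteq> set xs"
proof (rule ccontr)
  assume "\<not> ?thesis"
  then obtain k where k: "k < N" "k \<notin> set xs" "\<tau> k < test_stat Phi k (signal Phi theta xs + \<eta>)"
    by (auto simp: msd_estimate_def)
  let ?D = "deviation (gram Phi k) theta ({0..<N} - {k}) xs"
  let ?m = "mean_on ({0..<N} - {k}) (\<lambda>a. gram Phi k a (\<Sum>j<n. theta j))"
  have D: "norm ?D \<le> deviation_bound N n Phi theta \<delta> k"
    using xs(2) k(1,2) unfolding outlying_def mem_Collect_eq by (meson not_le)
  have len: "length xs = n" using xs by (simp add: tuples_def)
  have "transpose (Phi k) *v signal Phi theta xs = ?D + ?m"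
    by (simp add: signal_def deviation_def len linear_sum[OF matrix_vector_mul_linear] matrix_vector_mul_assoc
       )
  then have "norm (transpose (Phi k) *v (signal Phi theta xs + \<eta>)) =
      norm (?D + ?m + transpose (Phi k) *v \<eta>)"
    by (simp add: matrix_vector_right_distrib)
  also have "\<dots> \<le> norm ?D + norm ?m + norm (transpose (Phi k) *v \<eta>)"
    by (meson norm_triangle_ineq add_right_mono order_trans)
  also have "\<dots> \<le> deviation_bound N n Phi theta \<delta> k
      + avg_mixing_coherence N Phi k * sqrt (real n * energy n theta) + e"
    using D k N by (intro add_mono norm_mean_gram_le \<eta>) auto
  finally have "(norm (transpose (Phi k) *v (signal Phi theta xs + \<eta>)))\<^sup>2 \<le> \<tau> k"
    unfolding \<tau> by (intro power_mono) (auto simp: add_ac)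
  then show False using k by (simp add: test_stat_def)
qed

section \<open>Family-wise error under both noise models\<close>

theorem theorem1:
  fixes N n :: nat
    and Phi :: "nat \<Rightarrow> real^'d^'D"
    and theta :: "nat \<Rightarrow> real^'d"
    and \<alpha> :: real
  assumes "N \<ge> 3" and "1 \<le> n" and "n < N"
    and "\<And>i. i < N \<Longrightarrow> transpose (Phi i) ** Phi i = mat 1"
    and "\<And>i j. i < N \<Longrightarrow> j < N \<Longrightarrow> i \<noteq> j \<Longrightarrow>
           subspace_of (Phi i) \<inter> subspace_of (Phi j) = {0}"
    and "0 < \<alpha>" and "\<alpha> \<le> 1"
  shows
    "(\<forall>\<epsilon> (\<eta>::real^'D). norm \<eta> < \<epsilon> \<longrightarrow>
        measure_pmf.prob (pmf_of_set (tuples N n))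
          {xs. \<not> msd_estimate N Phi (tau_det N n Phi theta \<epsilon> \<alpha>) (signal Phi theta xs + \<eta>)
                  \<subseteq> set xs} \<le> \<alpha>)
     \<and> (\<forall>\<sigma>>0.
        measure (measure_pmf (pmf_of_set (tuples N n)) \<Otimes>\<^sub>M gaussian_vec \<sigma>)
          {(xs, \<eta>). \<not> msd_estimate N Phi (tau_gauss N n Phi theta \<sigma> \<alpha>) (signal Phi theta xs + \<eta>)
                  \<subseteq> set xs} \<le> \<alpha>)"
proof (intro conjI allI impI)
  note Phi = assms(4) and \<alpha> = \<open>0 < \<alpha>\<close> \<open>\<alpha> \<le> 1\<close>
  let ?p = "pmf_of_set (tuples N n)"
  have N: "N \<ge> 2" "real N \<ge> 3" using \<open>N \<ge> 3\<close> by auto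
  {
    fix \<epsilon> and \<eta> :: "real^'D" assume \<eta>: "norm \<eta> < \<epsilon>"
    let ?B = "outlying N n Phi theta (\<alpha> / N) \<union> - tuples N n"
    have "{xs. \<not> msd_estimate N Phi (tau_det N n Phi theta \<epsilon> \<alpha>) (signal Phi theta xs + \<eta>) \<subseteq> set xs} \<subseteq> ?B"
    proof (rule ccontr)
      assume "\<not> ?thesis"
      then obtain xs where xs: "xs \<in> tuples N n" "xs \<notin> outlying N n Phi theta (\<alpha> / N)"
        and "\<not> msd_estimate N Phi (tau_det N n Phi theta \<epsilon> \<alpha>) (signal Phi theta xs + \<eta>) \<subseteq> set xs"
        by auto
      moreover have "msd_estimate N Phi (tau_det N n Phi theta \<epsilon> \<alpha>) (signal Phi theta xs + \<eta>) \<subseteq> set xs"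
      proof (rule msd_estimate_subset[OF N(1) xs])
        show "norm (transpose (Phi k) *v \<eta>) \<le> \<epsilon>" if "k < N" for k
          using norm_transpose_orthonormal_columns_le[OF Phi[OF that], of \<eta>] \<eta> by linarith
      qed (simp add: tau_det_def deviation_bound_def)
      ultimately show False by blast
    qed
    then have "measure_pmf.prob ?p {xs. \<not> msd_estimate N Phi (tau_det N n Phi theta \<epsilon> \<alpha>)
        (signal Phi theta xs + \<eta>) \<subseteq> set xs} \<le> measure_pmf.prob ?p ?B"
      by (intro measure_pmf.finite_measure_mono) auto
    also have "\<dots> \<le> N * (\<alpha> / N)"
      using assms N by (intro prob_outlying_le) (auto simp: divide_le_eq)
    finally show "measure_pmf.prob ?p {xs. \<not> msd_estimate N Phi (tau_det N n Phi theta \<epsilon> \<alpha>)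
        (signal Phi theta xs + \<eta>) \<subseteq> set xs} \<le> \<alpha>"
      using N by simp
  }
  fix \<sigma> :: real assume \<sigma>: "\<sigma> > 0"
  let ?g = "gaussian_vec \<sigma> :: (real^'D) measure"
  interpret g: prob_space ?g by (rule prob_space_gaussian_vec[OF \<sigma>])
  interpret pair_prob_space "measure_pmf ?p" ?g ..
  \<comment> \<open>The error budget is halved: each of the N indices gets \<alpha> / (2N) for its
    deviation and the same for its noise, so that exp (- l) = \<alpha> / (2N).\<close>
  define l where "l = ln (2 * N / \<alpha>)"
  define e where "e = \<sigma> * sqrt (CARD('d) + 2 * l + 2 * sqrt (CARD('d) * l))"
  have l: "0 < l" "exp (- l) = \<alpha> / (2 * N)"
    using \<alpha> N by (simp_all add: l_def exp_minus)
  define B where "B = outlying N n Phi theta (\<alpha> / (2 * N)) \<union> - tuples N n"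
  define C where "C = (\<Union>k<N. {x. norm (transpose (Phi k) *v x) > e})"
  have C_sets: "{x. norm (transpose (Phi k) *v x) > e} \<in> sets ?g" for k
  proof -
    have "{x \<in> space ?g. norm (transpose (Phi k) *v x) > e} \<in> sets ?g" by measurable
    then show ?thesis by simp
  qed
  then have [measurable]: "C \<in> sets ?g" by (auto simp: C_def)
  let ?E = "{(xs, \<eta>). \<not> msd_estimate N Phi (tau_gauss N n Phi theta \<sigma> \<alpha>) (signal Phi theta xs + \<eta>)
                  \<subseteq> set xs}"
  \<comment> \<open>Covering the error event by a bad pattern or bad noise separates the two
    sources; under the product measure each set contributes only its marginal probability.\<close>
  have "?E \<subseteq> B \<times> UNIV \<union> UNIV \<times> C"
  proof (rule ccontr)
    assume "\<not> ?thesis"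
    then obtain xs \<eta> where xs: "xs \<in> tuples N n" "xs \<notin> outlying N n Phi theta (\<alpha> / (2 * N))"
      and \<eta>: "\<eta> \<notin> C"
      and "\<not> msd_estimate N Phi (tau_gauss N n Phi theta \<sigma> \<alpha>) (signal Phi theta xs + \<eta>) \<subseteq> set xs"
      by (auto simp: B_def)
    moreover have "msd_estimate N Phi (tau_gauss N n Phi theta \<sigma> \<alpha>) (signal Phi theta xs + \<eta>) \<subseteq> set xs"
    proof (rule msd_estimate_subset[OF N(1) xs])
      show "norm (transpose (Phi k) *v \<eta>) \<le> e" if "k < N" for k
        using \<eta> that by (auto simp: C_def not_less)
    qed (simp add: tau_gauss_def deviation_bound_def e_def l_def mult_ac)
    ultimately show False by blast
  qed
  then have "measure (measure_pmf ?p \<Otimes>\<^sub>M ?g) ?E \<le>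
      measure (measure_pmf ?p \<Otimes>\<^sub>M ?g) (B \<times> UNIV \<union> UNIV \<times> C)"
    by (rule P.finite_measure_mono) measurable
  also have "\<dots> \<le> measure (measure_pmf ?p \<Otimes>\<^sub>M ?g) (B \<times> UNIV)
      + measure (measure_pmf ?p \<Otimes>\<^sub>M ?g) (UNIV \<times> C)"
    by (rule measure_Un_le) measurable
  also have "\<dots> = measure_pmf.prob ?p B + measure ?g C"
  proof -
    have "emeasure (measure_pmf ?p \<Otimes>\<^sub>M ?g) (X \<times> Y) = emeasure (measure_pmf ?p) X * emeasure ?g Y"
      if "Y \<in> sets ?g" for X Y
      by (rule g.emeasure_pair_measure_Times) (use that in auto)
    from this[of UNIV B] this[of C UNIV] show ?thesis
      using measure_pmf.emeasure_space_1[of ?p] g.emeasure_space_1 \<open>C \<in> sets ?g\<close>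
      by (simp add: measure_def)
  qed
  also have "\<dots> \<le> N * (\<alpha> / (2 * N)) + N * (\<alpha> / (2 * N))"
  proof (rule add_mono)
    show "measure_pmf.prob ?p B \<le> N * (\<alpha> / (2 * N))"
      unfolding B_def using assms N by (intro prob_outlying_le) (auto simp: divide_le_eq)
    have "measure ?g C \<le> (\<Sum>k<N. measure ?g {x. norm (transpose (Phi k) *v x) > e})"
      unfolding C_def using C_sets by (intro g.finite_measure_subadditive_finite) auto
    also have "\<dots> \<le> (\<Sum>k<N. exp (- l))"
      unfolding e_def using Phi
      by (intro sum_mono gaussian_vec_norm_transpose_tail \<sigma> l) auto
    finally show "measure ?g C \<le> N * (\<alpha> / (2 * N))" by (simp add: l)
  qed
  also have "\<dots> = \<alpha>" using N by simp
  finally show "measure (measure_pmf ?p \<Otimes>\<^sub>M ?g) ?E \<le> \<alpha>" .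
qed

end
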